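(* Let $N$ be the number of phases and, for $1\le q\le N$, let $\alpha_q,\gamma_q,P_q,P_q^\infty$ be real numbers with $0\le\alpha_q\le 1$, $\sum_{q=1}^N\alpha_q=1$, $\gamma_q>1$ and $P_q\ge P_q^{\min}:=-P_q^\infty$, with the phases ordered so that $P_1^{\min}\ge P_2^{\min}\ge\dots\ge P_N^{\min}$. Define $$\mathcal F^P(\mathcal P)=\sum_{q=1}^N\frac{\mathcal P-P_q}{\mathcal P+P_q^\infty}\,\frac{\alpha_q}{\gamma_q}.$$ Then $\mathcal F^P(\mathcal P)=0$ has $N$ real roots in $(-\infty,P_N^{\min})$, $(P_{p+1}^{\min},P_p^{\min})$ for $1\le p\le N-1$, and $(P_1^{\min},+\infty)$, with precisely one root per interval.
   Context: Setting: an $N$-phase mixture. Phase $q$ has volume fraction $\alpha_q$, pressure $P_q$, density $\rho_q$ and specific internal energy $e_q$, with equation of state $\rho_q(e_q-e_q^\infty)=\frac{P_q+\gamma_q P_q^\infty}{\gamma_q-1}$, where $\gamma_q$, $P_q^\infty$, $e_q^\infty$ are material-dependent parameters. The number $P_q^{\min}=-P_q^\infty$ is the minimal admissible pressure of phase $q$. The state before relaxation is assumed thermodynamically admissible, which gives the stated inequalities on $\alpha_q$ and $P_q$. The common pressure after instantaneous pressure relaxation is a zero of $\mathcal F^P$.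
   Formalization: The interval (-∞, P_N^min) contains no root (F^P > 0 there). One root in each other interval is proved if the phases at its endpoints have α_q > 0, P_q > P_q^min and, for inner ones, distinct P^min; N roots in total if all phases have α_q > 0, P_q > P_q^min and all P_q^min are distinct. *)

theory Defs
  imports "HOL-Analysis.Analysis"
begin

text \<open>Phase data are functions on \<open>nat\<close>; only the indices \<open>1, \<dots>, N\<close> are used.\<close>

definition Pmin :: "(nat \<Rightarrow> real) \<Rightarrow> nat \<Rightarrow> real" where
  "Pmin Pinf q = - Pinf q"

definition FP ::
  "nat \<Rightarrow> (nat \<Rightarrow> real) \<Rightarrow> (nat \<Rightarrow> real) \<Rightarrow> (nat \<Rightarrow> real) \<Rightarrow> (nat \<Rightarrow> real) \<Rightarrow> real \<Rightarrow> real" where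
  "FP N \<alpha> \<gamma> P Pinf x = (\<Sum>q=1..N. (x - P q) / (x + Pinf q) * (\<alpha> q / \<gamma> q))"

text \<open>Since \<open>y / 0 = 0\<close> in HOL, the points where a denominator vanishes, at which the
  mathematical function is undefined, have to be excluded explicitly.\<close>

definition FP_roots ::
  "nat \<Rightarrow> (nat \<Rightarrow> real) \<Rightarrow> (nat \<Rightarrow> real) \<Rightarrow> (nat \<Rightarrow> real) \<Rightarrow> (nat \<Rightarrow> real) \<Rightarrow> real set" where
  "FP_roots N \<alpha> \<gamma> P Pinf =
     {x. (\<forall>q\<in>{1..N}. x + Pinf q \<noteq> 0) \<and> FP N \<alpha> \<gamma> P Pinf x = 0}"

text \<open>The \<open>q\<close>-th summand equals \<open>(\<alpha> q / \<gamma> q) * (1 - (P q - Pmin Pinf q) / (x - Pmin Pinf q))\<close>.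
  It has a genuine pole at \<open>Pmin Pinf q\<close> exactly when phase \<open>q\<close> is present and its pressure is
  strictly above the minimal one; otherwise it is constant off that point and
  need not force a root in an adjacent interval.\<close>

definition has_pole ::
  "(nat \<Rightarrow> real) \<Rightarrow> (nat \<Rightarrow> real) \<Rightarrow> (nat \<Rightarrow> real) \<Rightarrow> nat \<Rightarrow> bool" where
  "has_pole \<alpha> P Pinf q \<longleftrightarrow> \<alpha> q > 0 \<and> P q > Pmin Pinf q"

end

theory Submission
  imports Defs "HOL-Real_Asymp.Real_Asymp"
begin

text \<open>Off its pole \<open>m = Pmin Pinf q\<close>, the \<open>q\<close>-th summand is a nonnegative multiple of
  \<open>1 - (P q - m) / (x - m)\<close>, which is nondecreasing on either side of \<open>m\<close> and, for a genuine
  pole, runs to \<open>\<infinity>\<close> at \<open>m\<close> from the left and to \<open>-\<infinity>\<close> from the right. Hence \<open>FP\<close>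
  increases strictly from \<open>-\<infinity>\<close> to \<open>\<infinity>\<close> between neighbouring poles. To the right of all
  poles it increases from \<open>-\<infinity>\<close> to \<open>\<Sum>q. \<alpha> q / \<gamma> q > 0\<close>, and to the left of all poles every
  quotient is at least \<open>1\<close>, so that there is no root.\<close>

section \<open>Monotonicity and limits of a single quotient\<close>

lemma mobius_mono:
  fixes m P x y :: real
  assumes "m \<le> P" "x \<le> y" "m \<notin> {x..y}"
  shows "(x - P) / (x - m) \<le> (y - P) / (y - m)"
proof -
  \<comment> \<open>With \<open>m\<close> outside \<open>{x..y}\<close>, both points lie on the same
    side of the pole.\<close>
  have pos: "(x - m) * (y - m) > 0"
    using assms by (auto simp: zero_less_mult_iff)
  then have "x \<noteq> m" "y \<noteq> m" by auto
  then have "(y - P) / (y - m) - (x - P) / (x - m) = (P - m) * (y - x) / ((x - m) * (y - m))"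
    by (simp add: field_simps)
  also have "\<dots> \<ge> 0"
    using assms pos by simp
  finally show ?thesis by simp
qed

lemma mobius_strict_mono:
  fixes m P x y :: real
  assumes "m < P" "x < y" "m \<notin> {x..y}"
  shows "(x - P) / (x - m) < (y - P) / (y - m)"
proof -
  have pos: "(x - m) * (y - m) > 0"
    using assms by (auto simp: zero_less_mult_iff)
  then have "x \<noteq> m" "y \<noteq> m" by auto
  then have "(y - P) / (y - m) - (x - P) / (x - m) = (P - m) * (y - x) / ((x - m) * (y - m))"
    by (simp add: field_simps)
  also have "\<dots> > 0"
    using assms pos by simp
  finally show ?thesis by simp
qed

lemma mobius_at_right:
  fixes m P a :: real
  assumes "m < P" "a > 0"
  shows "filterlim (\<lambda>x. (x - P) / (x - m) * a) at_bot (at_right m)"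
proof -
  have "filterlim (\<lambda>x. (x - P) * inverse (x - m)) at_bot (at_right m)"
  proof (rule filterlim_tendsto_neg_mult_at_bot)
    show "((\<lambda>x. x - P) \<longlongrightarrow> m - P) (at_right m)" by (intro tendsto_intros)
    show "filterlim (\<lambda>x. inverse (x - m)) at_top (at_right m)" by real_asymp
  qed (use assms in simp)
  from filterlim_tendsto_pos_mult_at_bot[OF tendsto_const \<open>a > 0\<close> this] show ?thesis
    by (simp add: divide_inverse mult.commute)
qed

lemma mobius_at_left:
  fixes m P a :: real
  assumes "m < P" "a > 0"
  shows "filterlim (\<lambda>x. (x - P) / (x - m) * a) at_top (at_left m)"
proof -
  have "filterlim (\<lambda>x. (P - x) * inverse (m - x)) at_top (at_left m)"
  proof (rule filterlim_tendsto_pos_mult_at_top)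
    show "((\<lambda>x. P - x) \<longlongrightarrow> P - m) (at_left m)" by (intro tendsto_intros)
    show "filterlim (\<lambda>x. inverse (m - x)) at_top (at_left m)" by real_asymp
  qed (use assms in simp)
  moreover have "(x - P) / (x - m) = (P - x) * inverse (m - x)" for x
    by (metis divide_inverse minus_diff_eq minus_divide_divide)
  ultimately show ?thesis
    using filterlim_tendsto_pos_mult_at_top[OF tendsto_const \<open>a > 0\<close>]
    by (simp add: mult.commute)
qed

lemma mobius_at_top: "((\<lambda>x. (x - P) / (x - m)) \<longlongrightarrow> 1) at_top" for m P :: real
  by real_asymp

section \<open>Phase data: poles, weights and their order\<close>

locale phases =
  fixes N :: nat and \<alpha> \<gamma> P Pinf :: "nat \<Rightarrow> real"
  assumes alpha_nonneg: "q \<in> {1..N} \<Longrightarrow> \<alpha> q \<ge> 0"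
    and alpha_sum: "(\<Sum>q=1..N. \<alpha> q) = 1"
    and gamma_pos: "q \<in> {1..N} \<Longrightarrow> \<gamma> q > 0"
    and admissible: "q \<in> {1..N} \<Longrightarrow> P q \<ge> Pmin Pinf q"
    and Pmin_step: "p \<in> {1..<N} \<Longrightarrow> Pmin Pinf p \<ge> Pmin Pinf (p + 1)"
begin

abbreviation "m \<equiv> Pmin Pinf"
abbreviation "F \<equiv> FP N \<alpha> \<gamma> P Pinf"
abbreviation "w q \<equiv> \<alpha> q / \<gamma> q"

lemma F_eq: "F x = (\<Sum>q=1..N. (x - P q) / (x - m q) * w q)"
  by (simp add: FP_def Pmin_def)

lemma roots_iff: "x \<in> FP_roots N \<alpha> \<gamma> P Pinf \<longleftrightarrow> (\<forall>q\<in>{1..N}. x \<noteq> m q) \<and> F x = 0"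
  by (auto simp: FP_roots_def Pmin_def add_eq_0_iff2)

lemma w_nonneg: "q \<in> {1..N} \<Longrightarrow> w q \<ge> 0"
  using alpha_nonneg gamma_pos by (simp add: less_imp_le)

lemma w_pos: "q \<in> {1..N} \<Longrightarrow> has_pole \<alpha> P Pinf q \<Longrightarrow> w q > 0"
  using gamma_pos by (simp add: has_pole_def)

lemma N_pos: "N \<ge> 1"
  using alpha_sum by (cases N) auto

text \<open>This sum is the limit of \<open>F\<close> at infinity and a lower bound for
  \<open>F\<close> to the left of all poles.\<close>

lemma sum_w_pos: "(\<Sum>q=1..N. w q) > 0"
proof -
  obtain q where q: "q \<in> {1..N}" "\<alpha> q \<noteq> 0"
    using alpha_sum by (metis sum.neutral zero_neq_one)
  then have "w q > 0"
    using alpha_nonneg[of q] gamma_pos[of q] by simp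
  then show ?thesis
    using q w_nonneg by (intro sum_pos2[of _ q]) auto
qed

lemma m_antimono:
  assumes "1 \<le> p" "p \<le> q" "q \<le> N"
  shows "m q \<le> m p"
  using assms(2,3)
proof (induction rule: dec_induct)
  case (step k)
  with Pmin_step[of k] \<open>1 \<le> p\<close> show ?case by auto
qed simp

section \<open>Monotonicity and sign of \<open>F\<close> off the poles\<close>

text \<open>A general \<open>S\<close> allows \<open>{1..N} - {p}\<close>, the rest of
  \<open>F\<close> once the summand with the pole \<open>m p\<close> is split off.\<close>

lemma partial_mono:
  assumes "S \<subseteq> {1..N}" "x \<le> y" "\<And>q. q \<in> {1..N} \<Longrightarrow> m q \<notin> {x..y}"
  shows "(\<Sum>q\<in>S. (x - P q) / (x - m q) * w q) \<le> (\<Sum>q\<in>S. (y - P q) / (y - m q) * w q)"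
proof (rule sum_mono, rule mult_right_mono)
  fix q assume "q \<in> S"
  then have "q \<in> {1..N}" using assms(1) by auto
  then show "(x - P q) / (x - m q) \<le> (y - P q) / (y - m q)" "0 \<le> w q"
    using assms admissible w_nonneg by (auto intro!: mobius_mono simp del: atLeastAtMost_iff)
qed

lemma F_split:
  assumes "p \<in> {1..N}"
  shows "F x = (x - P p) / (x - m p) * w p
           + (\<Sum>q\<in>{1..N} - {p}. (x - P q) / (x - m q) * w q)"
  unfolding F_eq using assms by (simp add: sum.remove)

text \<open>One genuine pole anywhere outside \<open>{x..y}\<close> gives strictness, since the
  other summands do not decrease.\<close>

lemma F_strict_mono:
  assumes p: "p \<in> {1..N}" "has_pole \<alpha> P Pinf p"
    and xy: "x < y" "\<And>q. q \<in> {1..N} \<Longrightarrow> m q \<notin> {x..y}"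
  shows "F x < F y"
proof -
  have "(x - P p) / (x - m p) * w p < (y - P p) / (y - m p) * w p"
    using p xy w_pos by (intro mult_strict_right_mono mobius_strict_mono) (auto simp: has_pole_def)
  moreover have "(\<Sum>q\<in>{1..N} - {p}. (x - P q) / (x - m q) * w q)
               \<le> (\<Sum>q\<in>{1..N} - {p}. (y - P q) / (y - m q) * w q)"
    using xy by (intro partial_mono) auto
  ultimately show ?thesis
    unfolding F_split[OF p(1)] by (rule add_less_le_mono)
qed

text \<open>By monotonicity, the summands other than the \<open>p\<close>-th one are bounded near \<open>m p\<close> by
  their values at \<open>c\<close>, so the \<open>p\<close>-th one decides the sign. This also covers
  several phases sharing the pole \<open>m p\<close>.\<close>

lemma F_neg_right_of_pole:
  assumes p: "p \<in> {1..N}" "has_pole \<alpha> P Pinf p"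
    and c: "m p < c" "\<And>q. q \<in> {1..N} \<Longrightarrow> m q \<notin> {m p<..c}"
  shows "\<exists>x. m p < x \<and> x < c \<and> F x < 0"
proof -
  define R where "R x = (\<Sum>q\<in>{1..N} - {p}. (x - P q) / (x - m q) * w q)" for x
  have "filterlim (\<lambda>x. (x - P p) / (x - m p) * w p) at_bot (at_right (m p))"
    using p w_pos by (intro mobius_at_right) (auto simp: has_pole_def)
  then have "\<forall>\<^sub>F x in at_right (m p). (x - P p) / (x - m p) * w p < - R c"
    by (simp add: filterlim_at_bot_dense)
  moreover have "\<forall>\<^sub>F x in at_right (m p). x \<in> {m p<..<c}"
    using c(1) by (rule eventually_at_right_real)
  ultimately have "\<forall>\<^sub>F x in at_right (m p).
      (x - P p) / (x - m p) * w p < - R c \<and> x \<in> {m p<..<c}"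
    by (rule eventually_conj)
  then obtain x where x: "(x - P p) / (x - m p) * w p < - R c" "x \<in> {m p<..<c}"
    using eventually_happens[of _ "at_right (m p)"] by auto
  have "R x \<le> R c"
    unfolding R_def using x(2) c by (intro partial_mono) force+
  then show ?thesis
    using x F_split[OF p(1), of x, folded R_def] by auto
qed

lemma F_pos_left_of_pole:
  assumes p: "p \<in> {1..N}" "has_pole \<alpha> P Pinf p"
    and c: "c < m p" "\<And>q. q \<in> {1..N} \<Longrightarrow> m q \<notin> {c..<m p}"
  shows "\<exists>x. c < x \<and> x < m p \<and> F x > 0"
proof -
  define R where "R x = (\<Sum>q\<in>{1..N} - {p}. (x - P q) / (x - m q) * w q)" for x
  have "filterlim (\<lambda>x. (x - P p) / (x - m p) * w p) at_top (at_left (m p))"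
    using p w_pos by (intro mobius_at_left) (auto simp: has_pole_def)
  then have "\<forall>\<^sub>F x in at_left (m p). (x - P p) / (x - m p) * w p > - R c"
    by (simp add: filterlim_at_top_dense)
  moreover have "\<forall>\<^sub>F x in at_left (m p). x \<in> {c<..<m p}"
    using c(1) by (rule eventually_at_left_real)
  ultimately have "\<forall>\<^sub>F x in at_left (m p).
      (x - P p) / (x - m p) * w p > - R c \<and> x \<in> {c<..<m p}"
    by (rule eventually_conj)
  then obtain x where x: "(x - P p) / (x - m p) * w p > - R c" "x \<in> {c<..<m p}"
    using eventually_happens[of _ "at_left (m p)"] by auto
  have "R c \<le> R x"
    unfolding R_def using x(2) c by (intro partial_mono) force+
  then show ?thesis
    using x F_split[OF p(1), of x, folded R_def] by auto
qed

lemma F_pos_at_top: "\<exists>x>c. F x > 0"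
proof -
  have "((\<lambda>x. \<Sum>q=1..N. (x - P q) / (x - m q) * w q) \<longlongrightarrow> (\<Sum>q=1..N. 1 * w q)) at_top"
    by (intro tendsto_sum tendsto_mult tendsto_const mobius_at_top)
  then have "(F \<longlongrightarrow> (\<Sum>q=1..N. w q)) at_top"
    by (simp add: F_eq[abs_def])
  then have "\<forall>\<^sub>F x in at_top. F x > 0"
    using sum_w_pos by (rule order_tendstoD)
  then have "\<forall>\<^sub>F x in at_top. F x > 0 \<and> x > c"
    using eventually_gt_at_top[of c] by (rule eventually_conj)
  then show ?thesis
    using eventually_happens[of _ "at_top :: real filter"] by auto
qed

lemma F_pos_left:
  assumes "x < m N"
  shows "F x > 0"
proof -
  have "w q \<le> (x - P q) / (x - m q) * w q" if q: "q \<in> {1..N}" for q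
  proof -
    have "x < m q" using assms m_antimono[of q N] q by auto
    \<comment> \<open>Numerator and denominator are negative, and \<open>P q \<ge> m q\<close> makes
      the numerator at least as large in absolute value.\<close>
    then have "1 \<le> (x - P q) / (x - m q)"
      using admissible[OF q] by (simp add: le_divide_eq)
    from mult_right_mono[OF this w_nonneg[OF q]] show ?thesis
      by (simp only: mult_1_left)
  qed
  then have "(\<Sum>q=1..N. w q) \<le> F x"
    unfolding F_eq by (intro sum_mono)
  then show ?thesis using sum_w_pos by simp
qed

section \<open>Roots in the individual intervals\<close>

text \<open>Existence is the intermediate value theorem on \<open>{a..b}\<close>; uniqueness is
  strict monotonicity on \<open>I\<close>, for which \<open>p\<close> supplies the genuine pole. A
  general \<open>I\<close> covers bounded and unbounded intervals alike.\<close>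

lemma ex1_root:
  assumes I: "is_interval I" "\<And>q. q \<in> {1..N} \<Longrightarrow> m q \<notin> I"
    and p: "p \<in> {1..N}" "has_pole \<alpha> P Pinf p"
    and ab: "a \<in> I" "b \<in> I" "a < b" "F a < 0" "F b > 0"
  shows "\<exists>!x. x \<in> FP_roots N \<alpha> \<gamma> P Pinf \<inter> I"
proof -
  have sub: "{x..y} \<subseteq> I" if "x \<in> I" "y \<in> I" for x y
    using mem_is_interval_1_I[OF I(1) that] by auto
  have "continuous_on {a..b} F"
    unfolding F_eq[abs_def] using I(2) sub[OF ab(1,2)]
    by (intro continuous_intros) auto
  then obtain x where x: "a \<le> x" "x \<le> b" "F x = 0"
    using IVT'[of F a 0 b] ab by auto
  show ?thesis
  proof (rule ex1I)
    show "x \<in> FP_roots N \<alpha> \<gamma> P Pinf \<inter> I"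
      using x I(2) sub[OF ab(1,2)] by (auto simp: roots_iff)
  next
    fix y assume y: "y \<in> FP_roots N \<alpha> \<gamma> P Pinf \<inter> I"
    have "x \<in> I" using sub[OF ab(1,2)] x by auto
    have neq: "F u \<noteq> F v" if "u \<in> I" "v \<in> I" "u < v" for u v
    proof -
      have "F u < F v"
        using sub[OF that(1,2)] I(2) by (intro F_strict_mono[OF p that(3)]) blast
      then show ?thesis by simp
    qed
    have "F y = 0" "y \<in> I" using y by (auto simp: roots_iff)
    then show "y = x"
      using neq[of x y] neq[of y x] \<open>x \<in> I\<close> x(3) by (metis less_linear)
  qed
qed

lemma ex1_root_between:
  assumes p: "p \<in> {1..<N}" and poles: "has_pole \<alpha> P Pinf p" "has_pole \<alpha> P Pinf (p + 1)"
    and less: "m (p + 1) < m p"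
  shows "\<exists>!x. x \<in> FP_roots N \<alpha> \<gamma> P Pinf \<inter> {m (p + 1)<..<m p}"
proof -
  have gap: "m q \<le> m (p + 1) \<or> m p \<le> m q" if "q \<in> {1..N}" for q
    using that p m_antimono[of "p + 1" q] m_antimono[of q p] by (cases "q \<le> p") auto
  \<comment> \<open>The point \<open>c\<close> keeps the two witnesses apart: \<open>a\<close> is
    found to its left near the lower pole, \<open>b\<close> to its right near the upper one, whence
    \<open>a < b\<close>.\<close>
  obtain c where c: "m (p + 1) < c" "c < m p"
    using dense[OF less] by blast
  obtain a where a: "m (p + 1) < a" "a < c" "F a < 0"
    using F_neg_right_of_pole[OF _ poles(2) c(1)] p c(2) gap by fastforce
  obtain b where b: "c < b" "b < m p" "F b > 0"
    using F_pos_left_of_pole[OF _ poles(1) c(2)] p c(1) gap by fastforce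
  show ?thesis
  proof (rule ex1_root)
    show "p \<in> {1..N}" "has_pole \<alpha> P Pinf p" "F a < 0" "F b > 0"
      using p poles a b by auto
    show "m q \<notin> {m (p + 1)<..<m p}" if "q \<in> {1..N}" for q
      using gap[OF that] by auto
  qed (use a b c in \<open>auto simp: is_interval_oo\<close>)
qed

lemma ex1_root_right:
  assumes "has_pole \<alpha> P Pinf 1"
  shows "\<exists>!x. x \<in> FP_roots N \<alpha> \<gamma> P Pinf \<inter> {m 1<..}"
proof -
  have top: "m q \<le> m 1" if "q \<in> {1..N}" for q
    using that m_antimono[of 1 q] by auto
  \<comment> \<open>No pole lies beyond \<open>m 1\<close>, so any point to its right would serve in
    place of \<open>m 1 + 1\<close>.\<close>
  obtain a where a: "m 1 < a" "F a < 0"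
    using F_neg_right_of_pole[OF _ assms, of "m 1 + 1"] N_pos top by fastforce
  obtain b where b: "b > a" "F b > 0"
    using F_pos_at_top by blast
  show ?thesis
  proof (rule ex1_root)
    show "1 \<in> {1..N}" "has_pole \<alpha> P Pinf 1" "F a < 0" "F b > 0"
      using N_pos assms a b by auto
    show "m q \<notin> {m 1<..}" if "q \<in> {1..N}" for q
      using top[OF that] by auto
  qed (use a b in \<open>auto simp: is_interval_oi\<close>)
qed

lemma no_root_left: "FP_roots N \<alpha> \<gamma> P Pinf \<inter> {..<m N} = {}"
  using F_pos_left by (fastforce simp: roots_iff)

section \<open>Counting all roots\<close>

lemma card_roots:
  assumes poles: "\<And>q. q \<in> {1..N} \<Longrightarrow> has_pole \<alpha> P Pinf q"
    and strict: "\<And>p. p \<in> {1..<N} \<Longrightarrow> m (p + 1) < m p"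
  shows "card (FP_roots N \<alpha> \<gamma> P Pinf) = N"
proof -
  \<comment> \<open>Each interval is indexed by the pole at its left end; the case
    \<open>p = 1\<close> is unbounded, as index 0 is no phase.\<close>
  define I where "I p = {x. m p < x \<and> (p = 1 \<or> x < m (p - 1))}" for p
  have ex1: "\<exists>!x. x \<in> FP_roots N \<alpha> \<gamma> P Pinf \<inter> I p" if p: "p \<in> {1..N}" for p
  proof (cases "p = 1")
    case True
    then have "I p = {m 1<..}" by (auto simp: I_def)
    then show ?thesis using ex1_root_right poles N_pos by auto
  next
    case False
    then have "I p = {m (p - 1 + 1)<..<m (p - 1)}" using p by (auto simp: I_def)
    moreover have "p - 1 \<in> {1..<N}" "p - 1 + 1 \<in> {1..N}" using p False by auto
    ultimately show ?thesis
      using ex1_root_between[of "p - 1"] poles strict by auto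
  qed
  then obtain r where r: "\<And>p. p \<in> {1..N} \<Longrightarrow> r p \<in> FP_roots N \<alpha> \<gamma> P Pinf \<inter> I p"
    by metis
  \<comment> \<open>The pole \<open>m p\<close> separates the two roots, so distinct indices give
    distinct roots.\<close>
  have "r q < r p" if "p \<in> {1..N}" "q \<in> {1..N}" "p < q" for p q
  proof -
    have "r q < m (q - 1)" using r[OF that(2)] that by (auto simp: I_def)
    also have "\<dots> \<le> m p" using that by (intro m_antimono) auto
    also have "\<dots> < r p" using r[OF that(1)] by (auto simp: I_def)
    finally show ?thesis .
  qed
  then have inj: "inj_on r {1..N}"
    by (intro linorder_inj_onI') (metis less_irrefl)
  have "x \<in> r ` {1..N}" if x: "x \<in> FP_roots N \<alpha> \<gamma> P Pinf" for x
  proof -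
    have "m N < x"
      using x no_root_left N_pos
      by (metis IntI atLeastAtMost_iff emptyE lessThan_iff linorder_neqE order_refl roots_iff)
    \<comment> \<open>The least phase whose pole lies below \<open>x\<close> marks the interval of
      \<open>x\<close>. The conjunct \<open>1 \<le> p\<close> bars index 0, where \<open>m\<close>
      is arbitrary.\<close>
    define Q where "Q p \<longleftrightarrow> 1 \<le> p \<and> m p < x" for p
    define p where "p = (LEAST p. Q p)"
    have "Q N" using N_pos \<open>m N < x\<close> by (simp add: Q_def)
    have p: "1 \<le> p \<and> m p < x"
      using LeastI[of Q, OF \<open>Q N\<close>] unfolding p_def[symmetric] by (simp add: Q_def)
    have "p \<le> N"
      using Least_le[of Q, OF \<open>Q N\<close>] unfolding p_def[symmetric] .
    have "x \<in> I p"
    proof (cases "p = 1")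
      case False
      then have "p - 1 \<in> {1..N}" using p \<open>p \<le> N\<close> by auto
      \<comment> \<open>Minimality only gives \<open>x \<le> m (p - 1)\<close>; equality is excluded
        because roots avoid the poles.\<close>
      have "\<not> Q (p - 1)"
        using p False not_less_Least[of "p - 1" Q] unfolding p_def[symmetric] by simp
      moreover have "x \<noteq> m (p - 1)"
        using x p False \<open>p \<le> N\<close> \<open>p - 1 \<in> {1..N}\<close> unfolding roots_iff by blast
      ultimately show ?thesis using p False by (auto simp: I_def Q_def)
    qed (use p in \<open>auto simp: I_def\<close>)
    then have "x = r p"
      using ex1[of p] r[of p] x p \<open>p \<le> N\<close> by auto
    then show ?thesis using p \<open>p \<le> N\<close> by auto
  qed
  then have "FP_roots N \<alpha> \<gamma> P Pinf = r ` {1..N}"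
    using r by auto
  then show ?thesis
    using card_image[OF inj] by simp
qed

end

text \<open>The \<open>N + 1\<close> intervals cannot each hold one of only \<open>N\<close> roots:
  the leftmost one is free of roots. The other clauses ask for genuine poles and strict order, as
  otherwise an interval may be empty or contain no root.\<close>

theorem theorem3p1:
  fixes N :: nat and \<alpha> \<gamma> P Pinf :: "nat \<Rightarrow> real"
  assumes alpha_range: "\<forall>q\<in>{1..N}. 0 \<le> \<alpha> q \<and> \<alpha> q \<le> 1"
    and alpha_sum: "(\<Sum>q=1..N. \<alpha> q) = 1"
    and gamma: "\<forall>q\<in>{1..N}. \<gamma> q > 1"
    and admissible: "\<forall>q\<in>{1..N}. P q \<ge> Pmin Pinf q"
    and ordered: "\<forall>p\<in>{1..<N}. Pmin Pinf p \<ge> Pmin Pinf (p + 1)"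
  shows "((\<forall>q\<in>{1..N}. has_pole \<alpha> P Pinf q) \<and>
          (\<forall>p\<in>{1..<N}. Pmin Pinf (p + 1) < Pmin Pinf p)
            \<longrightarrow> card (FP_roots N \<alpha> \<gamma> P Pinf) = N) \<and>
         FP_roots N \<alpha> \<gamma> P Pinf \<inter> {..<Pmin Pinf N} = {} \<and>
         (\<forall>p\<in>{1..<N}.
            has_pole \<alpha> P Pinf p \<and> has_pole \<alpha> P Pinf (p + 1) \<and>
            Pmin Pinf (p + 1) < Pmin Pinf p
            \<longrightarrow> (\<exists>!x. x \<in> FP_roots N \<alpha> \<gamma> P Pinf \<inter> {Pmin Pinf (p + 1)<..<Pmin Pinf p})) \<and>
         (has_pole \<alpha> P Pinf 1
            \<longrightarrow> (\<exists>!x. x \<in> FP_roots N \<alpha> \<gamma> P Pinf \<inter> {Pmin Pinf 1<..}))"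
proof -
  interpret phases N \<alpha> \<gamma> P Pinf
    by unfold_locales (use assms in \<open>force+\<close>)
  show ?thesis
    using card_roots no_root_left ex1_root_between ex1_root_right by blast
qed

end
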